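(* The set $\{X\in M_2 : X^2=I_2,\ X\neq I_2,\ X\neq -I_2\}$ of all real square roots of $I_2$ other than $\pm I_2$ forms a hyperboloid of one sheet in $\mathbb R^4$. This hyperboloid lies in the hyperplane $x_1+x_4=0$.
   Context: $M_2$ is the set of real $2\times 2$ matrices and $I_2$ is the identity matrix. A matrix $X=\begin{bmatrix} x_1 & x_2 \\ x_3 & x_4 \end{bmatrix}\in M_2$ is identified with the point $(x_1,x_2,x_3,x_4)$ of Euclidean space $\mathbb R^4$. A subset of $\mathbb R^4$ is called a hyperboloid of one sheet if it is contained in some three-dimensional affine subspace (hyperplane) $H$ of $\mathbb R^4$ and, with respect to some rectangular (orthonormal) Cartesian coordinate system $(x,y,z)$ on $H$, it is exactly the set of points of $H$ satisfying $\frac{x^2}{a^2}+\frac{y^2}{b^2}-\frac{z^2}{c^2}=1$ for some $a,b,c>0$. *)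

theory Defs
  imports "HOL-Analysis.Analysis"
begin

definition vec_of_matrix :: "real^2^2 \<Rightarrow> real^4" where
  "vec_of_matrix X = vector [X $ 1 $ 1, X $ 1 $ 2, X $ 2 $ 1, X $ 2 $ 2]"

lemma vec_of_matrix_nth [simp]:
  "vec_of_matrix X $ 1 = X $ 1 $ 1" "vec_of_matrix X $ 2 = X $ 1 $ 2"
  "vec_of_matrix X $ 3 = X $ 2 $ 1" "vec_of_matrix X $ 4 = X $ 2 $ 2"
  by (simp_all add: vec_of_matrix_def vector_def)

text \<open>A rectangular Cartesian coordinate system on \<open>H\<close> is given by its origin \<open>p\<close> and the
  orthonormal directions \<open>u\<close>, \<open>v\<close>, \<open>w\<close> of its axes; the point with coordinates
  \<open>(x, y, z)\<close> is \<open>p + x u + y v + z w\<close>.\<close>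

definition cartesian_frame ::
  "(real^4) set \<Rightarrow> real^4 \<Rightarrow> real^4 \<Rightarrow> real^4 \<Rightarrow> real^4 \<Rightarrow> bool" where
  "cartesian_frame H p u v w \<longleftrightarrow>
     norm u = 1 \<and> norm v = 1 \<and> norm w = 1 \<and>
     orthogonal u v \<and> orthogonal u w \<and> orthogonal v w \<and>
     H = {p + x *\<^sub>R u + y *\<^sub>R v + z *\<^sub>R w | x y z. True}"

definition hyperboloid_of_one_sheet :: "(real^4) set \<Rightarrow> bool" where
  "hyperboloid_of_one_sheet S \<longleftrightarrow>
     (\<exists>H p u v w a b c. affine H \<and> aff_dim H = 3 \<and> cartesian_frame H p u v w \<and>
        a > 0 \<and> b > 0 \<and> c > 0 \<and>
        S = {p + x *\<^sub>R u + y *\<^sub>R v + z *\<^sub>R w | x y z.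
               x\<^sup>2 / a\<^sup>2 + y\<^sup>2 / b\<^sup>2 - z\<^sup>2 / c\<^sup>2 = 1})"

end

theory Submission
  imports Defs
begin

text \<open>
  By Cayley--Hamilton a \<open>2 \<times> 2\<close> matrix satisfies \<open>X\<^sup>2 = t X - d I\<close>, where \<open>t\<close> is the trace and
  \<open>d\<close> the determinant. If \<open>X\<^sup>2 = I\<close> and \<open>t \<noteq> 0\<close>, then \<open>X\<close> is a scalar matrix, hence \<open>X = \<plusminus>I\<close>;
  if \<open>t = 0\<close>, then \<open>X\<^sup>2 = I\<close> says just that \<open>d = -1\<close>, and \<open>X\<close> is not
  \<open>\<plusminus>I\<close>, whose trace is \<open>\<plusminus>2\<close>. So the square roots other than \<open>\<plusminus>I\<close> are the
  matrices of trace \<open>0\<close> and determinant \<open>-1\<close>, which in coordinates are the solutions of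
  \<open>x\<^sub>1 + x\<^sub>4 = 0\<close>, \<open>x\<^sub>1\<^sup>2 + x\<^sub>2 x\<^sub>3 = 1\<close> (lemma \<open>image_nontrivial_square_roots\<close>).

  The first equation cuts out a hyperplane. The second is brought to normal form by rotating the
  \<open>(x\<^sub>2, x\<^sub>3)\<close>-plane by 45 degrees, which turns the product \<open>x\<^sub>2 x\<^sub>3\<close> into half a difference of squares.
  In the orthonormal coordinates of the lemma \<open>cartesian_frame_trace_zero\<close> the equation becomes
  \<open>x\<^sup>2/2 + y\<^sup>2/2 - z\<^sup>2/2 = 1\<close>, so all three semi-axes equal \<open>\<surd>2\<close>.
\<close>

lemma vec4_eq_iff:
  fixes x y :: "real^4"
  shows "x = y \<longleftrightarrow> x $ 1 = y $ 1 \<and> x $ 2 = y $ 2 \<and> x $ 3 = y $ 3 \<and> x $ 4 = y $ 4"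
  by (simp add: vec_eq_iff forall_4)

lemma vector_4_nth:
  fixes a b c d :: real
  shows "(vector [a, b, c, d] :: real^4) $ 1 = a" "(vector [a, b, c, d] :: real^4) $ 2 = b"
    "(vector [a, b, c, d] :: real^4) $ 3 = c" "(vector [a, b, c, d] :: real^4) $ 4 = d"
  by (simp_all add: vector_def)

text \<open>
  The off-diagonal entries of \<open>X\<^sup>2\<close> are those of \<open>X\<close> multiplied by the trace, and the diagonal
  entries differ by the trace times the difference of those of \<open>X\<close>. A nonzero trace thus makes \<open>X\<close>
  scalar.
\<close>

lemma nontrivial_square_root_iff:
  fixes X :: "real^2^2"
  shows "X ** X = mat 1 \<and> X \<noteq> mat 1 \<and> X \<noteq> - mat 1 \<longleftrightarrow>
    X$1$1 + X$2$2 = 0 \<and> (X$1$1)\<^sup>2 + X$1$2 * X$2$1 = 1"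
proof -
  define a b c d where "a = X$1$1" and "b = X$1$2" and "c = X$2$1" and "d = X$2$2"
  have sq: "X ** X = mat 1 \<longleftrightarrow> a\<^sup>2 + b * c = 1 \<and> (a + d) * b = 0 \<and> (a + d) * c = 0 \<and> d\<^sup>2 + b * c = 1"
    unfolding a_def b_def c_def d_def
    by (auto simp: vec_eq_iff forall_2 matrix_matrix_mult_def sum_2 mat_def power2_eq_square algebra_simps)
  have id: "X = mat 1 \<longleftrightarrow> a = 1 \<and> b = 0 \<and> c = 0 \<and> d = 1"
    and neg: "X = - mat 1 \<longleftrightarrow> a = -1 \<and> b = 0 \<and> c = 0 \<and> d = -1"
    unfolding a_def b_def c_def d_def by (auto simp: vec_eq_iff forall_2 mat_def)
  have "a + d = 0" if root: "X ** X = mat 1" and nontriv: "X \<noteq> mat 1" "X \<noteq> - mat 1"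
  proof (rule ccontr)
    assume "a + d \<noteq> 0"
    with root sq have "b = 0" "c = 0" "a\<^sup>2 = 1" "d\<^sup>2 = 1" by auto
    with \<open>a + d \<noteq> 0\<close> nontriv id neg show False
      by (auto simp: power2_eq_1_iff)
  qed
  moreover have "X ** X = mat 1 \<and> X \<noteq> mat 1 \<and> X \<noteq> - mat 1"
    if trace: "a + d = 0" and det: "a\<^sup>2 + b * c = 1"
  proof -
    have "d = - a" using trace by simp
    then show ?thesis using det sq id neg by auto
  qed
  ultimately show ?thesis
    using sq unfolding a_def b_def c_def d_def by blast
qed

lemma image_nontrivial_square_roots:
  "vec_of_matrix ` {X :: real^2^2. X ** X = mat 1 \<and> X \<noteq> mat 1 \<and> X \<noteq> - mat 1} =
    {x. x $ 1 + x $ 4 = 0 \<and> (x $ 1)\<^sup>2 + x $ 2 * x $ 3 = 1}" (is "_ = ?Q")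
proof -
  have "x \<in> vec_of_matrix ` {X. X$1$1 + X$2$2 = 0 \<and> (X$1$1)\<^sup>2 + X$1$2 * X$2$1 = 1}" if "x \<in> ?Q" for x
  proof (rule image_eqI)
    let ?X = "vector [vector [x $ 1, x $ 2], vector [x $ 3, x $ 4]] :: real^2^2"
    show "x = vec_of_matrix ?X" by (simp add: vec4_eq_iff)
    show "?X \<in> {X. X$1$1 + X$2$2 = 0 \<and> (X$1$1)\<^sup>2 + X$1$2 * X$2$1 = 1}" using that by simp
  qed
  then show ?thesis by (auto simp: nontrivial_square_root_iff)
qed

text \<open>
  The axes correspond to the matrices \<open>diag(1, -1)\<close>, the symmetric and the skew-symmetric
  off-diagonal matrix, scaled to unit length. The last two diagonalise the product \<open>x\<^sub>2 x\<^sub>3\<close>.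
\<close>

definition axis_diag :: "real^4" where
  "axis_diag = vector [1 / sqrt 2, 0, 0, - (1 / sqrt 2)]"

definition axis_sym :: "real^4" where
  "axis_sym = vector [0, 1 / sqrt 2, 1 / sqrt 2, 0]"

definition axis_skew :: "real^4" where
  "axis_skew = vector [0, 1 / sqrt 2, - (1 / sqrt 2), 0]"

lemmas axis_defs = axis_diag_def axis_sym_def axis_skew_def

text \<open>
  The summand \<open>0\<close> is the origin of the frame, kept so that the expression has the shape that
  \<open>cartesian_frame\<close> and \<open>hyperboloid_of_one_sheet\<close> unfold to.
\<close>

abbreviation trace_zero_point :: "real \<Rightarrow> real \<Rightarrow> real \<Rightarrow> real^4" where
  "trace_zero_point x y z \<equiv> 0 + x *\<^sub>R axis_diag + y *\<^sub>R axis_sym + z *\<^sub>R axis_skew"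

lemma trace_zero_point_nth:
  "trace_zero_point x y z $ 1 = x / sqrt 2"
  "trace_zero_point x y z $ 2 = (y + z) / sqrt 2"
  "trace_zero_point x y z $ 3 = (y - z) / sqrt 2"
  "trace_zero_point x y z $ 4 = - (x / sqrt 2)"
  by (simp_all add: axis_defs vector_4_nth add_divide_distrib diff_divide_distrib)

lemma trace_zero_point_surj:
  assumes "x $ 1 + x $ 4 = 0"
  shows "\<exists>r s t. x = trace_zero_point r s t"
proof (intro exI)
  have half: "a / sqrt 2 / sqrt 2 = a / 2" for a :: real
    by simp
  have "(x$2 + x$3) / sqrt 2 + (x$2 - x$3) / sqrt 2 = 2 * x$2 / sqrt 2"
    "(x$2 + x$3) / sqrt 2 - (x$2 - x$3) / sqrt 2 = 2 * x$3 / sqrt 2"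
    by (simp_all add: field_simps)
  then show "x = trace_zero_point (sqrt 2 * x $ 1) ((x $ 2 + x $ 3) / sqrt 2) ((x $ 2 - x $ 3) / sqrt 2)"
    using assms unfolding vec4_eq_iff trace_zero_point_nth by (simp add: half)
qed

lemma cartesian_frame_trace_zero:
  "cartesian_frame {x. x $ 1 + x $ 4 = 0} 0 axis_diag axis_sym axis_skew"
  unfolding cartesian_frame_def
proof (intro conjI)
  show "norm axis_diag = 1" "norm axis_sym = 1" "norm axis_skew = 1"
    by (simp_all add: norm_eq_1 inner_vec_def sum_4 axis_defs vector_4_nth)
  show "orthogonal axis_diag axis_sym" "orthogonal axis_diag axis_skew" "orthogonal axis_sym axis_skew"
    by (simp_all add: orthogonal_def inner_vec_def sum_4 axis_defs vector_4_nth)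
  show "{x. x $ 1 + x $ 4 = 0} = {trace_zero_point x y z | x y z. True}"
  proof (intro equalityI subsetI)
    fix x :: "real^4" assume "x \<in> {x. x $ 1 + x $ 4 = 0}"
    then show "x \<in> {trace_zero_point x y z | x y z. True}"
      using trace_zero_point_surj by blast
  next
    fix x assume "x \<in> {trace_zero_point x y z | x y z. True}"
    then obtain r s t where "x = trace_zero_point r s t" by blast
    then show "x \<in> {x. x $ 1 + x $ 4 = 0}"
      by (simp only: trace_zero_point_nth mem_Collect_eq)
  qed
qed

lemma trace_zero_hyperplane:
  "affine {x :: real^4. x $ 1 + x $ 4 = 0}" "aff_dim {x :: real^4. x $ 1 + x $ 4 = 0} = 3"
proof -
  let ?n = "vector [1, 0, 0, 1] :: real^4"
  have H: "{x :: real^4. x $ 1 + x $ 4 = 0} = {x. ?n \<bullet> x = 0}"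
    by (simp add: inner_vec_def sum_4 vector_4_nth)
  have "?n \<noteq> 0" by (simp add: vec4_eq_iff vector_4_nth)
  then show "affine {x :: real^4. x $ 1 + x $ 4 = 0}"
    "aff_dim {x :: real^4. x $ 1 + x $ 4 = 0} = 3"
    by (simp_all add: H affine_hyperplane)
qed

lemma quadric_at_trace_zero_point:
  "(trace_zero_point x y z $ 1)\<^sup>2 + trace_zero_point x y z $ 2 * trace_zero_point x y z $ 3
    = x\<^sup>2 / (sqrt 2)\<^sup>2 + y\<^sup>2 / (sqrt 2)\<^sup>2 - z\<^sup>2 / (sqrt 2)\<^sup>2"
  unfolding trace_zero_point_nth by (simp add: power_divide field_simps power2_eq_square)

theorem corollary1:
  defines "S \<equiv> vec_of_matrix ` {X :: real^2^2. X ** X = mat 1 \<and> X \<noteq> mat 1 \<and> X \<noteq> - mat 1}"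
  shows "hyperboloid_of_one_sheet S \<and> S \<subseteq> {x. x $ 1 + x $ 4 = 0}"
proof
  have S: "S = {x. x $ 1 + x $ 4 = 0 \<and> (x $ 1)\<^sup>2 + x $ 2 * x $ 3 = 1}"
    unfolding S_def by (rule image_nontrivial_square_roots)
  then show "S \<subseteq> {x. x $ 1 + x $ 4 = 0}" by blast
  have "{x :: real^4. x $ 1 + x $ 4 = 0} = {trace_zero_point x y z | x y z. True}"
    using cartesian_frame_trace_zero by (simp only: cartesian_frame_def)
  then have "S = {p. (\<exists>x y z. p = trace_zero_point x y z) \<and> (p $ 1)\<^sup>2 + p $ 2 * p $ 3 = 1}"
    unfolding S by blast
  also have "\<dots> = {trace_zero_point x y z | x y z. (trace_zero_point x y z $ 1)\<^sup>2
      + trace_zero_point x y z $ 2 * trace_zero_point x y z $ 3 = 1}"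
    by blast
  also have "\<dots> = {trace_zero_point x y z | x y z.
      x\<^sup>2 / (sqrt 2)\<^sup>2 + y\<^sup>2 / (sqrt 2)\<^sup>2 - z\<^sup>2 / (sqrt 2)\<^sup>2 = 1}"
    by (simp only: quadric_at_trace_zero_point)
  finally show "hyperboloid_of_one_sheet S"
    unfolding hyperboloid_of_one_sheet_def
    using trace_zero_hyperplane cartesian_frame_trace_zero
    by (intro exI[of _ "{x. x $ 1 + x $ 4 = 0}"] exI[of _ 0] exI[of _ axis_diag] exI[of _ axis_sym]
        exI[of _ axis_skew] exI[of _ "sqrt 2"]) simp
qed

end
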